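(* For every integer $k\ge 0$ there exists a semi-bar $k$-visibility graph $G$ whose thickness satisfies $\Theta(G)\ge \left\lceil \frac{2}{3}(k+1)\right\rceil$.
   Context: The thickness $\Theta(G)$ of a finite simple graph $G$ is the minimum number of planar subgraphs of $G$ whose union is $G$. A bar $k$-visibility representation of a graph is a finite set of pairwise disjoint closed horizontal segments (bars) in the plane, in bijection with the vertices, such that two distinct vertices $u,v$ are adjacent if and only if there is a vertical segment that intersects the bars of $u$ and $v$ and at most $k$ other bars. A semi-bar $k$-visibility graph is a graph having a bar $k$-visibility representation in which the left endpoints of all bars (then called semi-bars) have $x$-coordinate $0$. *)

theory Defs
  imports "HOL-Analysis.Analysis"
begin

definition simple_graph :: "'a set \<Rightarrow> 'a set set \<Rightarrow> bool" where
  "simple_graph V E \<longleftrightarrow> finite V \<and> (\<forall>e\<in>E. e \<subseteq> V \<and> card e = 2)"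

definition simple_subgraph :: "'a set \<Rightarrow> 'a set set \<Rightarrow> 'a set \<Rightarrow> 'a set set \<Rightarrow> bool" where
  "simple_subgraph W F V E \<longleftrightarrow> simple_graph W F \<and> W \<subseteq> V \<and> F \<subseteq> E"

text \<open>The plane is the type \<^typ>\<open>complex\<close>, as in the library's Jordan curve theorem. Edges are
  drawn as arbitrary arcs (injective continuous curves).\<close>

definition plane_drawing ::
  "'a set \<Rightarrow> 'a set set \<Rightarrow> ('a \<Rightarrow> complex) \<Rightarrow> ('a set \<Rightarrow> real \<Rightarrow> complex) \<Rightarrow> bool" where
  "plane_drawing V E p \<gamma> \<longleftrightarrow>
     inj_on p V \<and>
     (\<forall>e\<in>E. arc (\<gamma> e) \<and> {pathstart (\<gamma> e), pathfinish (\<gamma> e)} = p ` e \<and>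
        path_image (\<gamma> e) \<inter> p ` V = p ` e) \<and>
     (\<forall>e\<in>E. \<forall>f\<in>E. e \<noteq> f \<longrightarrow> path_image (\<gamma> e) \<inter> path_image (\<gamma> f) = p ` (e \<inter> f))"

definition planar_graph :: "'a set \<Rightarrow> 'a set set \<Rightarrow> bool" where
  "planar_graph V E \<longleftrightarrow> simple_graph V E \<and> (\<exists>p \<gamma>. plane_drawing V E p \<gamma>)"

definition union_of_planar_subgraphs :: "nat \<Rightarrow> 'a set \<Rightarrow> 'a set set \<Rightarrow> bool" where
  "union_of_planar_subgraphs t V E \<longleftrightarrow>
     (\<exists>W F. (\<forall>i<t. simple_subgraph (W i) (F i) V E \<and> planar_graph (W i) (F i)) \<and>
        (\<Union>i<t. W i) = V \<and> (\<Union>i<t. F i) = E)"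

text \<open>Every finite simple graph is a finite union of planar subgraphs (its vertices and single
  edges), so the minimum exists.\<close>

definition thickness :: "'a set \<Rightarrow> 'a set set \<Rightarrow> nat" where
  "thickness V E = (LEAST t. union_of_planar_subgraphs t V E)"

definition horizontal_bar :: "real \<Rightarrow> real \<Rightarrow> real \<Rightarrow> complex set" where
  "horizontal_bar l r y = closed_segment (Complex l y) (Complex r y)"

definition vertical_segment :: "real \<Rightarrow> real \<Rightarrow> real \<Rightarrow> complex set" where
  "vertical_segment x a b = closed_segment (Complex x a) (Complex x b)"

text \<open>The bar of \<open>v\<close> has left endpoint \<open>(l v, y v)\<close> and right endpoint \<open>(r v, y v)\<close>.\<close>

definition bar_visibility_representation ::
  "nat \<Rightarrow> 'a set \<Rightarrow> 'a set set \<Rightarrow> ('a \<Rightarrow> real) \<Rightarrow> ('a \<Rightarrow> real) \<Rightarrow> ('a \<Rightarrow> real) \<Rightarrow> bool" where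
  "bar_visibility_representation k V E l r y \<longleftrightarrow>
     simple_graph V E \<and>
     (\<forall>v\<in>V. l v < r v) \<and>
     disjoint_family_on (\<lambda>v. horizontal_bar (l v) (r v) (y v)) V \<and>
     (\<forall>u\<in>V. \<forall>v\<in>V. u \<noteq> v \<longrightarrow>
        ({u, v} \<in> E \<longleftrightarrow>
          (\<exists>x a b.
             vertical_segment x a b \<inter> horizontal_bar (l u) (r u) (y u) \<noteq> {} \<and>
             vertical_segment x a b \<inter> horizontal_bar (l v) (r v) (y v) \<noteq> {} \<and>
             card {w \<in> V - {u, v}.
               vertical_segment x a b \<inter> horizontal_bar (l w) (r w) (y w) \<noteq> {}} \<le> k)))"

definition semi_bar_visibility_graph :: "nat \<Rightarrow> 'a set \<Rightarrow> 'a set set \<Rightarrow> bool" where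
  "semi_bar_visibility_graph k V E \<longleftrightarrow>
     (\<exists>l r y. bar_visibility_representation k V E l r y \<and> (\<forall>v\<in>V. l v = 0))"

end

theory Submission
  imports Defs
begin

text \<open>Take n bars whose lengths increase outwards on alternating sides; they have at least
  (2k + 2)(n - 2k - 2) visibility edges. A planar graph on n vertices has at most 3n edges, so t planar
  subgraphs cover the graph only if 3nt is at least that number, and for large n this forces
  3t \<ge> 2k + 2.

  For drawings with arbitrary arcs the bound on the edges of a planar graph is obtained without faces.
  A graph with at least 3n - 1 edges has a \<open>K\<^sub>5\<close> minor (Mader): contract edges lying in at most two
  triangles as long as possible, and then inspect the neighbourhood of a vertex of degree at most 5.
  A drawing in the plane has no \<open>K\<^sub>5\<close> minor: if the fifth branch set is joined to the other four, then
  none of these is separated from it by the triangle on the remaining three. Take a point separated from the fifth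
  branch set by one triangle. The theta graphs formed by two triangles show that no other triangle
  separates it, whereas by Janiszewski's theorem three nonseparating triangles imply that the fourth
  does not separate either.\<close>

subsection \<open>Drawings of the complete graph on five vertices\<close>

text \<open>\<open>A\<close>, \<open>B\<close>, \<open>C\<close> play the roles of the three arcs of a theta graph, \<open>A\<close> including the poles. If the
  conclusion failed, the faces of \<open>x\<close> in the complements of \<open>A \<union> B\<close> and \<open>A \<union> C\<close> would coincide, so its
  frontier would lie in \<open>A\<close>, which does not separate the plane.\<close>

lemma theta_separation:
  fixes A B C :: "'a::real_normed_vector set"
  assumes clo: "closed A" "closed B" "closed C"
    and connA: "connected (- A)" and BC: "B \<inter> C \<subseteq> A"
    and connB: "connected (B - A)" and connC: "connected (C - A)"
    and c: "c \<in> C - A" "connected_component (- (A \<union> B)) c a"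
    and b: "b \<in> B - A" "connected_component (- (A \<union> C)) b a"
    and x: "x \<notin> A \<union> B"
    and sepB: "\<not> connected_component (- (A \<union> B)) x a"
  shows "connected_component (- (A \<union> C)) x a"
proof (rule ccontr)
  assume sepC: "\<not> connected_component (- (A \<union> C)) x a"
  define U where "U = connected_component_set (- (A \<union> B)) x"
  define W where "W = connected_component_set (- (A \<union> C)) x"
  have xU: "x \<in> U"
    using x by (simp add: U_def)
  have UA: "U \<subseteq> - (A \<union> B)" and WA: "W \<subseteq> - (A \<union> C)"
    unfolding U_def W_def by (rule connected_component_subset)+
  \<comment> \<open>\<open>C - A\<close> is connected, misses \<open>B\<close> by \<open>BC\<close>,
    and contains \<open>c\<close>, which is joined to \<open>a\<close>. If the component of
    \<open>x\<close> met \<open>C\<close>, it would therefore contain \<open>a\<close>.\<close>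
  have meet: "\<not> connected_component (- (A \<union> B)) x z" if "z \<in> C" for z
  proof
    assume z: "connected_component (- (A \<union> B)) x z"
    then have "z \<in> C - A"
      using that by (meson ComplD DiffI UnI1 connected_component_in)
    then have "connected_component (- (A \<union> B)) z c"
      unfolding connected_component_def
      using connC c(1) BC by (intro exI[of _ "C - A"]) auto
    then show False
      using z c(2) sepB connected_component_trans by metis
  qed
  have meet': "\<not> connected_component (- (A \<union> C)) x z" if "z \<in> B" for z
  proof
    assume z: "connected_component (- (A \<union> C)) x z"
    then have "z \<in> B - A"
      using that by (meson ComplD DiffI UnI1 connected_component_in)
    then have "connected_component (- (A \<union> C)) z b"
      unfolding connected_component_def
      using connB b(1) BC by (intro exI[of _ "B - A"]) auto
    then show False
      using z b(2) sepC connected_component_trans by metis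
  qed
  have "U \<subseteq> W"
    unfolding W_def
  proof (rule connected_component_maximal[OF xU])
    show "connected U" unfolding U_def by simp
    show "U \<subseteq> - (A \<union> C)"
      using UA meet by (auto simp: U_def)
  qed
  moreover have "W \<subseteq> U"
    unfolding U_def
  proof (rule connected_component_maximal)
    show "x \<in> W" using xU \<open>U \<subseteq> W\<close> by blast
    show "connected W" unfolding W_def by simp
    show "W \<subseteq> - (A \<union> B)"
      using WA meet' by (auto simp: W_def)
  qed
  ultimately have "U = W" by blast
  have "frontier U \<subseteq> A \<union> B" "frontier W \<subseteq> A \<union> C"
    unfolding U_def W_def
    using clo by (metis closed_Un frontier_complement frontier_of_connected_component_subset
        frontier_subset_eq order_trans)+
  then have "frontier U \<subseteq> A"
    using BC \<open>U = W\<close> by blast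
  \<comment> \<open>The connected set \<open>- A\<close> contains \<open>x\<close> in
    \<open>U\<close> and \<open>a\<close> outside \<open>U\<close>, so it crosses the frontier of
    \<open>U\<close>.\<close>
  moreover have "- A \<inter> frontier U \<noteq> {}"
  proof (rule connected_Int_frontier[OF connA])
    show "- A \<inter> U \<noteq> {}"
      using xU UA by blast
    have "a \<in> - A"
      using c(2) connected_component_in by blast
    moreover have "a \<notin> U"
      using sepB by (simp add: U_def)
    ultimately show "- A - U \<noteq> {}"
      by blast
  qed
  ultimately show False by blast
qed

text \<open>Contracted form of a drawing of \<open>K\<^sub>5\<close>: each vertex \<open>i\<close> is blown up to a continuum \<open>C i\<close>, and
  \<open>q i j\<close> is the point where the edge between \<open>i\<close> and \<open>j\<close> leaves \<open>C i\<close>.\<close>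

locale k5_drawing =
  fixes K :: "'i set" and C :: "'i \<Rightarrow> complex set" and E :: "'i \<Rightarrow> 'i \<Rightarrow> complex set"
    and q :: "'i \<Rightarrow> 'i \<Rightarrow> complex"
  assumes C_props: "i \<in> K \<Longrightarrow> compact (C i) \<and> connected (C i) \<and> connected (- C i)"
    and C_disjoint: "\<lbrakk>i \<in> K; j \<in> K; i \<noteq> j\<rbrakk> \<Longrightarrow> C i \<inter> C j = {}"
    and E_commute: "E i j = E j i"
    and E_props: "\<lbrakk>i \<in> K; j \<in> K; i \<noteq> j\<rbrakk> \<Longrightarrow> compact (E i j) \<and> connected (E i j) \<and> connected (- E i j)"
    and E_end: "\<lbrakk>i \<in> K; j \<in> K; i \<noteq> j\<rbrakk> \<Longrightarrow> E i j \<inter> C i = {q i j} \<and> connected (E i j - C i)"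
    and E_C: "\<lbrakk>i \<in> K; j \<in> K; l \<in> K; i \<noteq> j; l \<noteq> i; l \<noteq> j\<rbrakk> \<Longrightarrow> E i j \<inter> C l = {}"
    and E_adjacent: "\<lbrakk>i \<in> K; j \<in> K; l \<in> K; i \<noteq> j; i \<noteq> l; j \<noteq> l\<rbrakk> \<Longrightarrow> E i j \<inter> E i l \<subseteq> C i"
    and E_disjoint: "\<lbrakk>i \<in> K; j \<in> K; l \<in> K; m \<in> K; distinct [i, j, l, m]\<rbrakk> \<Longrightarrow> E i j \<inter> E l m = {}"
begin

section \<open>Triangles and their pieces in the contracted drawing\<close>

definition tri :: "'i \<Rightarrow> 'i \<Rightarrow> 'i \<Rightarrow> complex set" where
  "tri a b c = C a \<union> C b \<union> C c \<union> E a b \<union> E b c \<union> E a c"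

definition link :: "'i \<Rightarrow> 'i \<Rightarrow> complex set" where
  "link a b = C a \<union> E a b \<union> C b"

text \<open>The outer sets \<open>C a\<close> and \<open>C c\<close> are left out, so that for
  distinct vertices the path meets \<open>link a c\<close> only in two contact points.\<close>

definition path3 :: "'i \<Rightarrow> 'i \<Rightarrow> 'i \<Rightarrow> complex set" where
  "path3 a b c = E a b \<union> C b \<union> E b c"

lemma contact:
  assumes "i \<in> K" "j \<in> K" "i \<noteq> j"
  shows "q i j \<in> E i j" "q i j \<in> C i" "q j i \<in> E i j" "q j i \<in> C j" "q i j \<noteq> q j i"
  using E_end[of i j] E_end[of j i] assms E_commute[of i j] C_disjoint[of i j] by auto

lemma tri_perm: "tri a b c = tri b a c" "tri a b c = tri a c b"
  unfolding tri_def using E_commute[of a b] E_commute[of b c] by auto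

lemma compact_tri:
  assumes "a \<in> K" "b \<in> K" "c \<in> K" "distinct [a, b, c]"
  shows "compact (tri a b c)"
  unfolding tri_def using assms C_props E_props by (simp add: compact_Un)

text \<open>The three pieces are glued successively along single points. By Janiszewski's theorem, a
  union of nonseparating pieces with connected intersection does not separate either.\<close>

lemma link:
  assumes "a \<in> K" "b \<in> K" "a \<noteq> b"
  shows "compact (link a b)" "connected (link a b)" "connected (- link a b)"
proof -
  note contact = contact[OF assms]
  have 1: "connected (C a \<union> E a b)"
    using assms C_props E_props contact by (intro connected_Un) auto
  show "connected (link a b)"
    unfolding link_def using assms C_props E_props contact by (intro connected_Un 1) auto
  show "compact (link a b)"
    unfolding link_def using assms C_props E_props by (simp add: compact_Un)
  have "C a \<inter> E a b = {q a b}"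
    using E_end[of a b] assms by auto
  then have 2: "connected (- (C a \<union> E a b))"
    using assms C_props E_props by (intro Janiszewski_connected) (auto intro: compact_imp_closed)
  have "(C a \<union> E a b) \<inter> C b = {q b a}"
    using E_end[of b a] C_disjoint[of a b] E_commute[of a b] assms by auto
  then show "connected (- link a b)"
    unfolding link_def
    using assms C_props E_props by (intro Janiszewski_connected 2) (auto intro: compact_imp_closed)
qed

text \<open>Removing the link only cuts the outer ends off the two edges. By \<open>E_end\<close>
  each trimmed edge stays connected, and both still touch \<open>C b\<close>.\<close>

lemma path3:
  assumes "a \<in> K" "b \<in> K" "c \<in> K" "distinct [a, b, c]"
  shows "compact (path3 a b c)" "connected (path3 a b c)" "connected (path3 a b c - link a c)"
    "C b \<subseteq> path3 a b c - link a c"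
proof -
  have neq: "a \<noteq> b" "b \<noteq> c" "a \<noteq> c"
    using assms by auto
  note q1 = contact[OF assms(1,2) neq(1)] and q2 = contact[OF assms(2,3) neq(2)]
  show "compact (path3 a b c)"
    unfolding path3_def using assms C_props E_props by (simp add: compact_Un)
  have 1: "connected (E a b \<union> C b)"
    using assms C_props E_props q1 by (intro connected_Un) auto
  show "connected (path3 a b c)"
    unfolding path3_def using assms C_props E_props q2 by (intro connected_Un 1) auto
  have eq: "path3 a b c - link a c = (E a b - C a) \<union> C b \<union> (E c b - C c)"
    unfolding path3_def link_def
    using C_disjoint[of a b] C_disjoint[of b c] E_C[of a b c] E_C[of b c a] E_C[of a c b]
      E_adjacent[of a b c] E_adjacent[of c b a] E_commute[of a c] E_commute[of b c] assms
    by auto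
  have q': "q b a \<in> E a b - C a" "q b c \<in> E c b - C c"
    using q1 q2 C_disjoint[of a b] C_disjoint[of b c] E_commute[of b c] assms by auto
  have 2: "connected ((E a b - C a) \<union> C b)"
    using q' q1 assms C_props E_end by (intro connected_Un) auto
  show "connected (path3 a b c - link a c)"
    unfolding eq using q' q2 assms C_props E_end by (intro connected_Un 2) auto
  show "C b \<subseteq> path3 a b c - link a c"
    unfolding eq by auto
qed

lemma tri_eq:
  assumes "a \<in> K" "b \<in> K" "c \<in> K" "distinct [a, b, c]"
  shows "tri a b c = link a b \<union> path3 a c b"
  unfolding tri_def link_def path3_def using E_commute[of b c] by auto

text \<open>By the converse form of Janiszewski's theorem, two continua whose union does not
  separate have connected intersection; here the intersection consists of two distinct
  points.\<close>

lemma not_connected_compl_tri: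
  assumes "a \<in> K" "b \<in> K" "c \<in> K" "distinct [a, b, c]"
  shows "\<not> connected (- tri a b c)"
proof
  assume "connected (- tri a b c)"
  then have "connected (link a b \<inter> path3 a c b)"
    using assms link[of a b] path3[of a c b]
    by (intro Janiszewski_dual) (auto simp: tri_eq)
  moreover have "link a b \<inter> path3 a c b = {q a c, q b c}"
  proof -
    have "E a b \<inter> E a c \<subseteq> C a" "E a b \<inter> E c b \<subseteq> C b"
      using E_adjacent[of a b c] E_adjacent[of b a c] E_commute[of b a] E_commute[of c b] assms
      by auto
    moreover have "C a \<inter> E a c = {q a c}" "C b \<inter> E c b = {q b c}"
      using E_end[of a c] E_end[of b c] E_commute[of c b] assms by auto
    moreover have "C a \<inter> C c = {}" "C b \<inter> C c = {}"
      using C_disjoint assms by auto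
    moreover have "C a \<inter> E c b = {}" "C b \<inter> E a c = {}" "E a b \<inter> C c = {}"
      using E_C[of b c a] E_C[of a c b] E_C[of a b c] E_commute[of c b] assms by auto
    ultimately have *: "E a b \<inter> E a c \<subseteq> {q a c}" "E a b \<inter> E c b \<subseteq> {q b c}"
      "C a \<inter> E a c = {q a c}" "C b \<inter> E c b = {q b c}" "C a \<inter> C c = {}" "C b \<inter> C c = {}"
      "C a \<inter> E c b = {}" "C b \<inter> E a c = {}" "E a b \<inter> C c = {}"
      by blast+
    show ?thesis
      unfolding path3_def link_def Int_Un_distrib Int_Un_distrib2 using * by auto
  qed
  moreover have "q a c \<noteq> q b c"
    using contact[of a c] contact[of b c] C_disjoint[of a b] assms by auto
  ultimately show False
    using connected_finite_iff_sing[of "{q a c, q b c}"] by auto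
qed

text \<open>Outside the shared link the triangles consist of the stars at \<open>a\<close> and at
  \<open>b\<close>. These can touch only where edges arrive at a common end, inside
  \<open>C c\<close> or \<open>C d\<close>.\<close>

lemma tri_Int_tri:
  assumes K: "a \<in> K" "b \<in> K" "c \<in> K" "d \<in> K" and dist: "distinct [a, b, c, d]"
  shows "tri a c d \<inter> tri b c d = link c d"
proof -
  have neq: "a \<noteq> b" "a \<noteq> c" "a \<noteq> d" "b \<noteq> c" "b \<noteq> d" "c \<noteq> d"
    using dist by auto
  have EA: "E a c \<inter> E b c \<subseteq> C c" "E a d \<inter> E b d \<subseteq> C d"
    using neq K E_adjacent E_commute by metis+
  have EE: "E a c \<inter> E b d = {}" "E a d \<inter> E b c = {}"
    using neq K E_disjoint by auto
  have EC: "E a c \<inter> C b = {}" "E a d \<inter> C b = {}"  "E c d \<inter> C b = {}" "E b c \<inter> C a = {}"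
    "E b d \<inter> C a = {}" "E c d \<inter> C a = {}"
    using neq K E_C by auto
  have CC: "C a \<inter> C b = {}" "C a \<inter> C c = {}" "C a \<inter> C d = {}" "C b \<inter> C c = {}" "C b \<inter> C d = {}"
    using neq K C_disjoint by auto
  have "(E a c \<union> E a d \<union> C a) \<inter> (E b c \<union> E b d \<union> C b) \<subseteq> C c \<union> C d"
    unfolding Int_Un_distrib Int_Un_distrib2 using EA CC EC EE by (auto simp: Int_commute)
  moreover have "tri a c d = link c d \<union> (E a c \<union> E a d \<union> C a)" "tri b c d = link c d \<union> (E b c \<union> E b d \<union> C b)"
    "C c \<union> C d \<subseteq> link c d"
    unfolding tri_def link_def by auto
  ultimately show ?thesis
    by auto
qed

text \<open>The triangle \<open>abc\<close> is the sum modulo 2 of the other three.\<close>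

lemma three_triangles:
  assumes K: "a \<in> K" "b \<in> K" "c \<in> K" "d \<in> K" and dist: "distinct [a, b, c, d]"
    and cc: "connected_component (- tri b c d) x y" "connected_component (- tri a c d) x y"
      "connected_component (- tri a b d) x y"
  shows "connected_component (- tri a b c) x y"
proof -
  have comp: "compact (tri b c d)" "compact (tri a c d)" "compact (tri a b d)"
    using compact_tri K dist by auto
  have neq: "a \<noteq> b" "a \<noteq> c" "a \<noteq> d" "b \<noteq> c" "b \<noteq> d" "c \<noteq> d"
    using dist by auto
  have 1: "tri b c d \<inter> tri a c d = link c d"
    using tri_Int_tri[of b a c d] K neq by auto
  have "tri a c d \<inter> tri a b d = link a d" "tri b c d \<inter> tri a b d = link b d"
    using tri_Int_tri[of c b a d] tri_Int_tri[of c a b d] tri_perm(1)[of c a d] tri_perm(1)[of b a d]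
      tri_perm(1)[of c b d] K neq by auto
  then have 2: "(tri b c d \<union> tri a c d) \<inter> tri a b d = link a d \<union> link b d"
    by blast
  \<comment> \<open>Both links contain \<open>C d\<close>, so the second intersection is connected
    as well and Janiszewski's theorem applies again.\<close>
  have 3: "connected (link a d \<union> link b d)"
    using link[of a d] link[of b d] K neq contact[of a d] by (intro connected_Un) (auto simp: link_def)
  have "connected (link c d)"
    using link K neq by auto
  then have 4: "connected_component (- (tri b c d \<union> tri a c d)) x y"
    using cc comp by (intro Janiszewski[of "tri b c d" "tri a c d"]) (simp_all only: 1 compact_imp_closed)
  have "connected_component (- ((tri b c d \<union> tri a c d) \<union> tri a b d)) x y"
    using cc comp 3 4
    by (intro Janiszewski[of "tri b c d \<union> tri a c d" "tri a b d"])
      (simp_all only: 2 compact_imp_closed compact_Un)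
  then show ?thesis
    by (rule connected_component_of_subset) (auto simp: tri_def)
qed

text \<open>The two triangles form a theta graph with common part \<open>link a b\<close>. The
  points \<open>v\<close> and \<open>u\<close> lie on the paths through \<open>c\<close> and
  \<open>d\<close>, and each reaches \<open>y\<close> without crossing the triangle opposite to it,
  as \<open>theta_separation\<close> demands.\<close>

lemma two_triangles:
  assumes K: "a \<in> K" "b \<in> K" "c \<in> K" "d \<in> K" and dist: "distinct [a, b, c, d]"
    and d: "u \<in> C d" "connected_component (- tri a b c) u y"
    and c: "v \<in> C c" "connected_component (- tri a b d) v y"
    and x: "x \<notin> tri a b c" "\<not> connected_component (- tri a b c) x y"
  shows "connected_component (- tri a b d) x y"
proof -
  have neq: "a \<noteq> b" "a \<noteq> c" "a \<noteq> d" "b \<noteq> c" "b \<noteq> d" "c \<noteq> d"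
    using dist by auto
  have t: "tri a b c = link a b \<union> path3 a c b" "tri a b d = link a b \<union> path3 a d b"
    using tri_eq K neq by auto
  have "path3 a c b \<inter> path3 a d b \<subseteq> link a b"
  proof -
    have "E a c \<inter> E a d \<subseteq> C a" "E c b \<inter> E d b \<subseteq> C b"
      using E_adjacent[of a c d] E_adjacent[of b c d] E_commute[of b c] E_commute[of b d] K neq
      by auto
    moreover have "C c \<inter> C d = {}" "E a c \<inter> E d b = {}" "E c b \<inter> E a d = {}"
      using C_disjoint[of c d] E_disjoint[of a c d b] E_disjoint[of c b a d] K neq by auto
    moreover have "E a c \<inter> C d = {}" "E c b \<inter> C d = {}" "C c \<inter> E a d = {}" "C c \<inter> E d b = {}"
      using E_C[of a c d] E_C[of c b d] E_C[of a d c] E_C[of d b c] K neq by auto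
    ultimately show ?thesis
      unfolding path3_def link_def Int_Un_distrib Int_Un_distrib2 by auto
  qed
  moreover have "compact (link a b)" "compact (path3 a c b)" "compact (path3 a d b)"
    "connected (- link a b)" "connected (path3 a c b - link a b)" "connected (path3 a d b - link a b)"
    "u \<in> path3 a d b - link a b" "v \<in> path3 a c b - link a b"
    using link[of a b] path3[of a c b] path3[of a d b] K neq c(1) d(1) by auto
  ultimately show ?thesis
    using x c(2) d(2) unfolding t
    by (intro theta_separation[of "link a b" "path3 a c b" "path3 a d b" u y v x] compact_imp_closed)
qed

text \<open>The continuum \<open>link i e\<close> joins the two points and misses the triangle,
  because the two have no vertex in common.\<close>

lemma spoke:
  assumes "e \<in> K" "i \<in> K" "a \<in> K" "b \<in> K" "c \<in> K" "distinct [e, i, a, b, c]"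
    "u \<in> C i" "y \<in> C e"
  shows "connected_component (- tri a b c) u y"
  unfolding connected_component_def
proof (intro exI conjI)
  show "connected (link i e)"
    using link assms by auto
  show "link i e \<subseteq> - tri a b c"
  proof -
    have "C i \<inter> C a = {}" "C i \<inter> C b = {}" "C i \<inter> C c = {}"
      "C e \<inter> C a = {}" "C e \<inter> C b = {}" "C e \<inter> C c = {}"
      using assms C_disjoint by auto
    moreover have "E a b \<inter> C i = {}" "E b c \<inter> C i = {}" "E a c \<inter> C i = {}"
      "E a b \<inter> C e = {}" "E b c \<inter> C e = {}" "E a c \<inter> C e = {}"
      "E i e \<inter> C a = {}" "E i e \<inter> C b = {}" "E i e \<inter> C c = {}"
      using assms E_C by auto
    moreover have "E i e \<inter> E a b = {}" "E i e \<inter> E b c = {}" "E i e \<inter> E a c = {}"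
      using assms E_disjoint[of i e a b] E_disjoint[of i e b c] E_disjoint[of i e a c] by auto
    ultimately show ?thesis
      unfolding disjoint_eq_subset_Compl[symmetric] tri_def link_def Int_Un_distrib Int_Un_distrib2
      by (simp add: Int_commute)
  qed
  show "u \<in> link i e" "y \<in> link i e"
    using assms by (auto simp: link_def)
qed

lemma no_five:
  assumes K: "a \<in> K" "b \<in> K" "c \<in> K" "d \<in> K" "e \<in> K" and dist: "distinct [a, b, c, d, e]"
  shows False
proof -
  have neq: "a \<noteq> b" "a \<noteq> c" "a \<noteq> d" "a \<noteq> e" "b \<noteq> c" "b \<noteq> d" "b \<noteq> e" "c \<noteq> d" "c \<noteq> e" "d \<noteq> e"
    using dist by auto
  have ne: "\<exists>z. z \<in> C i" if "i \<in> K" for i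
    using contact(2)[of i a] contact(2)[of i b] that K neq by metis
  obtain y where y: "y \<in> C e" using ne K by auto
  obtain u where u: "u \<in> C d" using ne K by auto
  obtain va vb vc where v: "va \<in> C a" "vb \<in> C b" "vc \<in> C c" using ne K by metis
  have su: "connected_component (- tri a b c) u y"
    using K neq u y by (intro spoke[of e d]) auto
  have "\<not> connected (- tri a b c)"
    using not_connected_compl_tri K neq by auto
  then obtain r s where rs: "r \<notin> tri a b c" "s \<notin> tri a b c" "\<not> connected_component (- tri a b c) r s"
    unfolding connected_iff_connected_component by auto
  \<comment> \<open>Points in different components cannot both share the component of
    \<open>y\<close>.\<close>
  have "\<not> connected_component (- tri a b c) r y \<or> \<not> connected_component (- tri a b c) s y"
    using rs(3) connected_component_sym connected_component_trans by metis
  with rs(1,2) obtain x where x: "x \<notin> tri a b c" "\<not> connected_component (- tri a b c) x y"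
    by blast
  have sv: "connected_component (- tri a b d) vc y" "connected_component (- tri a c d) vb y"
      "connected_component (- tri b c d) va y"
    using K neq v y spoke[of e c a b d vc y] spoke[of e b a c d vb y] spoke[of e a b c d va y]
    by auto
  have 1: "connected_component (- tri a b d) x y"
    using two_triangles[of a b c d u y vc x] K neq x u v su sv by auto
  have 2: "connected_component (- tri a c d) x y"
    using two_triangles[of a c b d u y vb x] K neq x u v su sv tri_perm(2)[of a b c] by auto
  have 3: "connected_component (- tri b c d) x y"
    using two_triangles[of b c a d u y va x] K neq x u v su sv tri_perm(1)[of a b c]
      tri_perm(2)[of b a c] by auto
  show False
    using three_triangles[of a b c d x y] K neq 1 2 3 x by auto
qed

end

subsection \<open>Minors of dense graphs\<close>

text \<open>Deleting a pair together with its reverse lowers the cardinality by one or two, so the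
  descent cannot jump over the window from \<open>n - 2\<close> to \<open>n - 1\<close>. This trims
  a dense graph until its average degree is below six.\<close>

lemma sym_subset_card:
  assumes "finite r" "sym r" "n \<le> card r + 2" "0 < n"
  shows "\<exists>s\<subseteq>r. sym s \<and> n \<le> card s + 2 \<and> card s < n"
  using assms
proof (induction r rule: finite_psubset_induct)
  case (psubset r)
  show ?case
  proof (cases "card r < n")
    case True
    then show ?thesis using psubset.prems by blast
  next
    case False
    then have "r \<noteq> {}"
      using psubset.prems(3) by auto
    then obtain x y where xy: "(x, y) \<in> r"
      by auto
    define s where "s = r - {(x, y), (y, x)}"
    have "s \<subset> r" using xy by (auto simp: s_def)
    moreover have "sym s" using psubset.prems(1) unfolding s_def sym_def by blast
    moreover have "card r - card {(x, y), (y, x)} \<le> card s"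
      unfolding s_def by (rule diff_card_le_card_Diff) simp
    moreover have "card {(x, y), (y, x)} \<le> 2"
      using card_length[of "[(x, y), (y, x)]"] by simp
    moreover have "card r - 2 \<le> card s"
      using calculation(3,4) by linarith
    ultimately have "\<exists>s'\<subseteq>s. sym s' \<and> n \<le> card s' + 2 \<and> card s' < n"
      using False by (intro psubset.IH psubset.prems(3)) simp_all
    then show ?thesis using \<open>s \<subset> r\<close> by blast
  qed
qed

text \<open>Isolates the combinatorics of contraction from drawings: \<open>T\<close> marks
  admissible branch sets and \<open>adj\<close> adjacency between them.\<close>

locale minor_model =
  fixes T :: "'a set \<Rightarrow> bool" and adj :: "'a set \<Rightarrow> 'a set \<Rightarrow> bool"
  assumes T_nonempty: "T B \<Longrightarrow> B \<noteq> {}"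
    and T_merge: "\<lbrakk>T B; T C; disjnt B C; adj B C\<rbrakk> \<Longrightarrow> T (B \<union> C)"
    and adj_sym: "adj B C \<Longrightarrow> adj C B"
    and adj_mono: "\<lbrakk>adj B D; B \<subseteq> C\<rbrakk> \<Longrightarrow> adj C D"
begin

definition branch_sets :: "'a set set \<Rightarrow> bool" where
  "branch_sets P \<longleftrightarrow> (\<forall>B\<in>P. T B) \<and> pairwise disjnt P"

definition K5_minor :: bool where
  "K5_minor \<longleftrightarrow> (\<exists>K. card K = 5 \<and> branch_sets K \<and> pairwise adj K)"

text \<open>A relation on the branch sets rather than all of \<open>adj\<close>, so that edges can be deleted. It consists
  of ordered pairs: its cardinality is twice the number of edges.\<close>

definition minor_edges :: "'a set set \<Rightarrow> 'a set rel \<Rightarrow> bool" where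
  "minor_edges P r \<longleftrightarrow> r \<subseteq> P \<times> P \<and> sym r \<and> irrefl r \<and> (\<forall>(B, C)\<in>r. adj B C)"

lemma minor_edgesD:
  assumes "minor_edges P r" "(B, C) \<in> r"
  shows "B \<in> P" "C \<in> P" "B \<noteq> C" "adj B C" "(C, B) \<in> r"
  using assms unfolding minor_edges_def by (auto simp: irrefl_def dest: symD)

lemma branch_sets_subset: "branch_sets P \<Longrightarrow> Q \<subseteq> P \<Longrightarrow> branch_sets Q"
  unfolding branch_sets_def using pairwise_subset by blast

lemma branch_setsD:
  assumes "branch_sets P" "B \<in> P"
  shows "T B" "C \<in> P \<Longrightarrow> B \<noteq> C \<Longrightarrow> disjnt B C"
  using assms by (simp_all add: branch_sets_def pairwise_def)

text \<open>A nonempty set disjoint from \<open>B \<union> C\<close> differs from it, so a merged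
  set is a new vertex and not an existing one.\<close>

lemma union_not_branch:
  assumes "branch_sets P" "B \<in> P" "C \<in> P" "D \<in> P" "D \<noteq> B" "D \<noteq> C"
  shows "disjnt (B \<union> C) D" "B \<union> C \<noteq> D"
proof -
  have "disjnt B D" "disjnt C D"
    using branch_setsD(2)[OF assms(1), of _ D] assms by auto
  then show "disjnt (B \<union> C) D"
    by simp
  then show "B \<union> C \<noteq> D"
    using T_nonempty[OF branch_setsD(1)[OF assms(1,4)]] by auto
qed

lemma branch_sets_contract:
  assumes "branch_sets P" "B \<in> P" "C \<in> P" "B \<noteq> C" "adj B C"
  shows "branch_sets (insert (B \<union> C) (P - {B, C}))"
proof -
  have "T (B \<union> C)"
    using branch_setsD[OF assms(1)] assms by (intro T_merge) auto
  moreover have "branch_sets (P - {B, C})"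
    using branch_sets_subset[OF assms(1)] by blast
  moreover have "disjnt (B \<union> C) D \<and> disjnt D (B \<union> C)" if "D \<in> P - {B, C}" for D
  proof -
    have "disjnt (B \<union> C) D"
      using union_not_branch(1)[OF assms(1-3)] that by simp
    then show ?thesis
      using disjnt_sym by blast
  qed
  ultimately show ?thesis
    by (simp add: branch_sets_def pairwise_insert)
qed

text \<open>In ordered pairs, the contracted edge costs two and each common neighbour costs two
  more, since its two edges become one. With at most two common neighbours the loss is at most
  six.\<close>

lemma contract:
  assumes P: "branch_sets P" "finite P" and r: "minor_edges P r" and e: "(B, C) \<in> r"
    and common: "card (r `` {B} \<inter> r `` {C}) \<le> 2"
  defines "Q \<equiv> P - {B, C}"
  shows "\<exists>s. minor_edges (insert (B \<union> C) Q) s \<and> card r \<le> card s + 6"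
proof -
  have BC: "B \<in> P" "C \<in> P" "B \<noteq> C" "adj B C" "(C, B) \<in> r"
    using minor_edgesD[OF r e] by auto
  define M where "M = B \<union> C"
  have MQ: "M \<notin> Q"
    using union_not_branch[OF P(1) BC(1,2)] by (auto simp: M_def Q_def)
  define NB where "NB = r `` {B} \<inter> Q"
  define NC where "NC = r `` {C} \<inter> Q"
  define s0 where "s0 = r \<inter> Q \<times> Q"
  define s where "s = s0 \<union> ({M} \<times> (NB \<union> NC) \<union> (NB \<union> NC) \<times> {M})"
  have fin: "finite Q" "finite NB" "finite NC" "finite s0"
    using P(2) by (auto simp: Q_def NB_def NC_def s0_def)
  have "minor_edges (insert M Q) s"
    unfolding minor_edges_def
  proof (intro conjI)
    show "s \<subseteq> insert M Q \<times> insert M Q"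
      by (auto simp: s_def s0_def NB_def NC_def)
    show "sym s"
    proof (rule symI)
      fix x y
      assume "(x, y) \<in> s"
      then show "(y, x) \<in> s"
        using minor_edgesD(5)[OF r] unfolding s_def s0_def by blast
    qed
    show "irrefl s"
      using r MQ by (auto simp: s_def s0_def minor_edges_def irrefl_def NB_def NC_def)
    have "adj M D" if "D \<in> NB \<union> NC" for D
    proof -
      have "adj B D \<or> adj C D"
        using that r by (auto simp: NB_def NC_def minor_edges_def)
      then show ?thesis
        unfolding M_def using adj_mono by blast
    qed
    then show "\<forall>(D, D')\<in>s. adj D D'"
      using r adj_sym unfolding s_def s0_def minor_edges_def by blast
  qed
  moreover have "card r \<le> card s + 6"
  proof -
    have "card (NB \<inter> NC) \<le> card (r `` {B} \<inter> r `` {C})"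
      using r P(2) by (intro card_mono) (auto simp: NB_def NC_def minor_edges_def
          intro: finite_subset[of _ P])
    then have 1: "card NB + card NC \<le> card (NB \<union> NC) + 2"
      using card_Un_Int[OF fin(2,3)] common by linarith
    have "r \<subseteq> s0 \<union> (({B} \<times> NB \<union> NB \<times> {B}) \<union> (({C} \<times> NC \<union> NC \<times> {C}) \<union> {(B, C), (C, B)}))"
    proof (rule subrelI)
      fix x y
      assume xy: "(x, y) \<in> r"
      then have "(y, x) \<in> r" "x \<noteq> y" "x \<in> P" "y \<in> P"
        using minor_edgesD[OF r xy] by auto
      then show "(x, y) \<in> s0 \<union> (({B} \<times> NB \<union> NB \<times> {B}) \<union> (({C} \<times> NC \<union> NC \<times> {C}) \<union> {(B, C), (C, B)}))"
        using xy by (auto simp: s0_def NB_def NC_def Q_def)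
    qed
    then have "card r \<le> card \<dots>"
      using fin by (intro card_mono) auto
    also have "\<dots> \<le> card s0 + (2 * card NB + (2 * card NC + 2))"
    proof -
      have star: "card ({D} \<times> A \<union> A \<times> {D}) \<le> 2 * card A" for D :: "'a set" and A
        using card_Un_le[of "{D} \<times> A" "A \<times> {D}"] by (simp add: card_cartesian_product)
      have "card {(B, C), (C, B)} \<le> 2"
        using card_length[of "[(B, C), (C, B)]"] by simp
      then show ?thesis
        using star[of B NB] star[of C NC] card_Un_le
        by (meson add_mono order_refl order_trans)
    qed
    finally have 2: "card r \<le> card s0 + 2 * (card NB + card NC) + 2"
      by simp
    have "card s = card s0 + (card (NB \<union> NC) + card (NB \<union> NC))"
    proof -
      have "card ({M} \<times> (NB \<union> NC) \<union> (NB \<union> NC) \<times> {M}) = card (NB \<union> NC) + card (NB \<union> NC)"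
        using fin MQ by (subst card_Un_disjoint) (auto simp: card_cartesian_product NB_def NC_def)
      then show ?thesis
        unfolding s_def using fin MQ
        by (subst card_Un_disjoint) (auto simp: s0_def)
    qed
    then have "card s + 6 = card s0 + 2 * (card (NB \<union> NC) + 2) + 2"
      by simp
    moreover have "2 * (card NB + card NC) \<le> 2 * (card (NB \<union> NC) + 2)"
      using 1 by (rule mult_le_mono2)
    ultimately show ?thesis
      using 2 by linarith
  qed
  ultimately show ?thesis
    unfolding M_def by blast
qed

text \<open>The neighbours of \<open>v\<close> span \<open>K\<^sub>4\<close>, or \<open>K\<^sub>5\<close> minus a matching; if two edges are missing, contracting an
  edge between them leaves \<open>K\<^sub>4\<close>.\<close>

lemma low_degree:
  assumes P: "branch_sets P" "finite P" "v \<in> P" and r: "minor_edges P r"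
    and deg: "card (r `` {v}) \<le> 5" "r `` {v} \<noteq> {}"
    and common: "\<And>B C. (B, C) \<in> r \<Longrightarrow> 3 \<le> card (r `` {B} \<inter> r `` {C})"
  shows K5_minor
proof -
  define N where "N = r `` {v}"
  have NP: "N \<subseteq> P" "v \<notin> N" and symr: "sym r"
    using r by (auto simp: N_def minor_edges_def irrefl_def)
  then have fN: "finite N"
    using P(2) finite_subset by blast
  have adj_r: "adj B C" if "(B, C) \<in> r" for B C
    using that r by (auto simp: minor_edges_def)
  have adj_v: "adj v B" "adj B v" if "B \<in> N" for B
  proof -
    show "adj v B" using that adj_r by (simp add: N_def)
    then show "adj B v" by (rule adj_sym)
  qed
  have irr: "(B, B) \<notin> r" for B
    using r by (auto simp: minor_edges_def irrefl_def)
  have three: "3 \<le> card (N \<inter> r `` {B})" if "B \<in> N" for B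
    using common[of v B] that by (simp add: N_def)
  \<comment> \<open>From \<open>N\<close> are removed \<open>B\<close> itself and the at least three
    neighbours that it shares with \<open>v\<close>.\<close>
  have nonadj: "card (N - r `` {B} - {B}) \<le> card N - 4" if "B \<in> N" for B
  proof -
    have "card (N - r `` {B} - {B}) = card (N - (N \<inter> r `` {B})) - 1"
      using that fN irr by (simp add: card_Diff_singleton Diff_Int)
    also have "\<dots> = card N - card (N \<inter> r `` {B}) - 1"
      using fN by (simp add: card_Diff_subset)
    finally show ?thesis
      using three[OF that] by linarith
  qed
  have clique: K5_minor if "M \<subseteq> N" "card M = 4" "\<And>B C. B \<in> M \<Longrightarrow> C \<in> M \<Longrightarrow> B \<noteq> C \<Longrightarrow> (B, C) \<in> r" for M
    unfolding K5_minor_def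
  proof (intro exI conjI)
    have "finite M" using that(1) fN finite_subset by blast
    then show "card (insert v M) = 5"
      using that(1,2) NP(2) by (subst card_insert_disjoint) auto
    show "branch_sets (insert v M)"
      using branch_sets_subset[OF P(1)] P(3) that(1) NP by blast
    show "pairwise adj (insert v M)"
      using that adj_v adj_r by (auto simp: pairwise_def)
  qed
  obtain B0 where "B0 \<in> N" using deg(2) by (auto simp: N_def)
  have "card (N \<inter> r `` {B0}) < card N"
    using fN irr \<open>B0 \<in> N\<close> by (intro psubset_card_mono) auto
  \<comment> \<open>\<open>B0\<close> has at least three neighbours in \<open>N\<close> besides
    itself, which leaves only these two sizes.\<close>
  then consider "card N = 4" | "card N = 5"
    using three[OF \<open>B0 \<in> N\<close>] deg(1) unfolding N_def by linarith
  then show ?thesis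
  proof cases
    case 1
    have "(B, C) \<in> r" if "B \<in> N" "C \<in> N" "B \<noteq> C" for B C
    proof -
      have "card (N - r `` {B} - {B}) = 0"
        using nonadj[OF that(1)] 1 by simp
      then show ?thesis
        using that fN by (simp only: card_0_eq finite_Diff) blast
    qed
    then show ?thesis using clique[of N] 1 by blast
  next
    case 2
    \<comment> \<open>Each neighbour of \<open>v\<close> misses at most one of the other four, so
      the missing edges form a matching.\<close>
    have full: "(B, D) \<in> r"
      if "B \<in> N" "C \<in> N" "D \<in> N" "(B, C) \<notin> r" "C \<noteq> B" "D \<noteq> B" "D \<noteq> C" for B C D
    proof (rule ccontr)
      assume "(B, D) \<notin> r"
      then have "card {C, D} \<le> card (N - r `` {B} - {B})"
        using that fN by (intro card_mono) auto
      then show False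
        using nonadj[OF that(1)] 2 \<open>D \<noteq> C\<close> by auto
    qed
    show ?thesis
    proof (cases "\<forall>B\<in>N. \<forall>C\<in>N. B \<noteq> C \<longrightarrow> (B, C) \<in> r")
      case True
      obtain M where "M \<subseteq> N" "card M = 4"
        by (rule obtain_subset_with_card_n[of 4 N]) (use 2 in auto)
      then show ?thesis using True clique[of M] by blast
    next
      case False
      then obtain a b where ab: "a \<in> N" "b \<in> N" "a \<noteq> b" "(a, b) \<notin> r" by blast
      then have ba: "(b, a) \<notin> r" using symD[OF symr] by blast
      show ?thesis
      proof (cases "\<forall>B\<in>N-{a}. \<forall>C\<in>N-{a}. B \<noteq> C \<longrightarrow> (B, C) \<in> r")
        case True
        then show ?thesis using clique[of "N - {a}"] 2 ab fN by auto
      next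
        case False
        then obtain c d where cd: "c \<in> N" "d \<in> N" "c \<noteq> a" "d \<noteq> a" "c \<noteq> d" "(c, d) \<notin> r" by blast
        then have dc: "(d, c) \<notin> r" using symD[OF symr] by blast
        \<comment> \<open>Two missing edges at \<open>b\<close> would contradict
          \<open>full\<close>, so the two gaps are disjoint pairs.\<close>
        have "c \<noteq> b" "d \<noteq> b"
          using full[of b a d] full[of b a c] ab ba cd dc by auto
        then have card4: "card {a, b, c, d} = 4"
          using ab cd by auto
        then have "card (N - {a, b, c, d}) = 1"
          using ab cd fN 2 by (subst card_Diff_subset) auto
        then obtain e where e: "N - {a, b, c, d} = {e}"
          by (rule card_1_singletonE)
        then have e: "e \<in> N" "e \<noteq> a" "e \<noteq> b" "e \<noteq> c" "e \<noteq> d" by auto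
        have er: "(a, e) \<in> r" "(b, e) \<in> r" "(d, e) \<in> r" "(a, d) \<in> r" "(c, b) \<in> r" "(b, d) \<in> r" "(c, e) \<in> r"
          using ab cd e ba dc \<open>c \<noteq> b\<close> \<open>d \<noteq> b\<close>
            full[of a b e] full[of b a e] full[of d c e] full[of a b d] full[of c d b]
            full[of b a d] full[of c d e] by simp_all
        \<comment> \<open>Contracting this edge repairs both gaps: \<open>a \<union> c\<close>
          reaches \<open>b\<close> through \<open>c\<close> and \<open>d\<close> through
          \<open>a\<close>.\<close>
        have ac: "(a, c) \<in> r"
          using full[of a b c] ab cd \<open>c \<noteq> b\<close> by simp
        have adj_ac: "adj (a \<union> c) x" if "(a, x) \<in> r \<or> (c, x) \<in> r" for x
          using that adj_r adj_mono[of a x "a \<union> c"] adj_mono[of c x "a \<union> c"] by blast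
        let ?K = "{a \<union> c, v, b, d, e}"
        have inP: "a \<in> P" "c \<in> P" "b \<in> P" "d \<in> P" "e \<in> P" "v \<in> P"
          using NP(1) P(3) ab cd e by blast+
        have vne: "v \<noteq> a" "v \<noteq> b" "v \<noteq> c" "v \<noteq> d" "v \<noteq> e"
          using NP(2) ab cd e by blast+
        have ne: "a \<union> c \<noteq> v" "a \<union> c \<noteq> b" "a \<union> c \<noteq> d" "a \<union> c \<noteq> e"
          using union_not_branch(2)[OF P(1) inP(1,2)] inP vne ab(3) cd e \<open>c \<noteq> b\<close> by metis+
        show ?thesis
          unfolding K5_minor_def
        proof (intro exI conjI)
          show "card ?K = 5"
            using ne vne e(3,5) \<open>d \<noteq> b\<close> by simp
          have "branch_sets (insert (a \<union> c) (P - {a, c}))"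
            using branch_sets_contract[OF P(1) inP(1,2) _ adj_r[OF ac]] cd(3) by blast
          moreover have "{v, b, d, e} \<subseteq> P - {a, c}"
            using inP vne e(2,4) ab(3) cd(4,5) \<open>c \<noteq> b\<close> by simp
          ultimately show "branch_sets ?K"
            by (meson branch_sets_subset insert_mono)
          have "(a, v) \<in> r"
            using ab(1) symD[OF symr] by (simp add: N_def)
          then have *: "adj (a \<union> c) v" "adj (a \<union> c) b" "adj (a \<union> c) d" "adj (a \<union> c) e"
            "adj v b" "adj v d" "adj v e" "adj b d" "adj b e" "adj d e"
            using adj_ac er by (simp_all add: adj_r adj_v ab cd e)
          show "pairwise adj ?K"
            using * *[THEN adj_sym] by (auto simp: pairwise_insert)
        qed
      qed
    qed
  qed
qed

text \<open>Induction on the number of branch sets. After trimming, some degree is at most five;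
  then either an edge in at most two triangles is contracted, or an isolated vertex is deleted, or
  \<open>low_degree\<close> finishes.\<close>

lemma K5_minor_if_dense:
  assumes "branch_sets P" "finite P" "P \<noteq> {}" "minor_edges P r" "6 * card P \<le> card r + 2"
  shows K5_minor
  using assms
proof (induction "card P" arbitrary: P r rule: less_induct)
  case less
  have "finite r"
    using less.prems finite_subset[of r "P \<times> P"] by (auto simp: minor_edges_def)
  moreover have "0 < 6 * card P"
    using less.prems by (simp add: card_gt_0_iff)
  ultimately obtain s where s: "s \<subseteq> r" "sym s" "6 * card P \<le> card s + 2" "card s < 6 * card P"
    using less.prems sym_subset_card[of r "6 * card P"] by (auto simp: minor_edges_def)
  have ms: "minor_edges P s"
    using s less.prems(4) by (auto simp: minor_edges_def irrefl_def)
  \<comment> \<open>The degrees sum to \<open>card s\<close>, which trimming has brought below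
    \<open>6 * card P\<close>.\<close>
  have "\<exists>v\<in>P. card (s `` {v}) \<le> 5"
  proof (rule ccontr)
    assume "\<not> ?thesis"
    then have "(\<Sum>v\<in>P. 6) \<le> (\<Sum>v\<in>P. card (s `` {v}))"
      by (intro sum_mono) (simp add: not_le Suc_le_eq numeral_eq_Suc)
    also have "\<dots> = card (SIGMA v:P. s `` {v})"
      using less.prems(2) ms by (intro card_SigmaI[symmetric]) (auto simp: minor_edges_def intro: finite_subset)
    also have "(SIGMA v:P. s `` {v}) = s"
      using ms by (auto simp: minor_edges_def)
    finally show False using s by simp
  qed
  then obtain v where v: "v \<in> P" "card (s `` {v}) \<le> 5" by blast
  show ?case
  proof (cases "\<exists>(B, C)\<in>s. card (s `` {B} \<inter> s `` {C}) \<le> 2")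
    case True
    then obtain B C where BC: "(B, C) \<in> s" "card (s `` {B} \<inter> s `` {C}) \<le> 2" by blast
    have PBC: "B \<in> P" "C \<in> P" "B \<noteq> C" "adj B C"
      using ms BC by (auto simp: minor_edges_def irrefl_def)
    let ?P = "insert (B \<union> C) (P - {B, C})"
    obtain t where t: "minor_edges ?P t" "card s \<le> card t + 6"
      using contract[OF less.prems(1,2) ms BC] by blast
    have "card ?P \<le> Suc (card (P - {B, C}))"
      by (simp add: card_insert_le_m1 card_insert_if less.prems(2))
    also have "card (P - {B, C}) = card P - 2"
      using PBC less.prems(2) by (simp add: card_Diff_subset)
    moreover have "2 \<le> card P"
      using card_mono[of P "{B, C}"] PBC less.prems(2) by simp
    \<comment> \<open>One vertex fewer pays for the loss of six ordered pairs, so the density bound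
      passes to the contracted graph.\<close>
    ultimately have c: "card ?P + 1 \<le> card P" by simp
    show ?thesis
      using c t s less.prems branch_sets_contract[OF less.prems(1) PBC]
      by (intro less.hyps[of ?P t]) auto
  next
    case no: False
    show ?thesis
    proof (cases "s `` {v} = {}")
      case True
      have ms': "minor_edges (P - {v}) s"
      proof -
        have "B \<noteq> v \<and> C \<noteq> v" if "(B, C) \<in> s" for B C
          using True minor_edgesD(5)[OF ms that] that by blast
        then show ?thesis
          using ms unfolding minor_edges_def by blast
      qed
      \<comment> \<open>A sole isolated vertex would leave \<open>s\<close> empty, against
        \<open>6 * card P \<le> card s + 2\<close>.\<close>
      have "P - {v} \<noteq> {}"
      proof
        assume "P - {v} = {}"
        then have "s = {}" using ms' by (auto simp: minor_edges_def)
        then show False using s(3) v less.prems(2) card_gt_0_iff[of P] by auto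
      qed
      moreover have "card (P - {v}) < card P"
        using v less.prems(2) by (meson card_Diff1_less)
      ultimately show ?thesis
        using ms' s less.prems branch_sets_subset[OF less.prems(1), of "P - {v}"]
        by (intro less.hyps[of "P - {v}" s]) auto
    next
      case False
      show ?thesis
        using low_degree[OF less.prems(1,2) v(1) ms v(2) False] no by fastforce
    qed
  qed
qed

end

subsection \<open>Edges of planar graphs\<close>

text \<open>Janiszewski's theorem is applied twice: \<open>D\<close> meets \<open>A\<close> in one
  point, and \<open>B\<close> meets \<open>A \<union> D\<close> in one point.\<close>

lemma bridge:
  fixes A B D :: "complex set"
  assumes A: "compact A" "connected A" "connected (- A)"
    and B: "compact B" "connected B" "connected (- B)"
    and D: "compact D" "connected D" "connected (- D)"
    and int: "A \<inter> B = {}" "D \<inter> A = {x}" "D \<inter> B = {y}"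
  shows "compact (A \<union> D \<union> B)" "connected (A \<union> D \<union> B)" "connected (- (A \<union> D \<union> B))"
proof -
  have 1: "A \<inter> D = {x}" "(A \<union> D) \<inter> B = {y}"
    using int by auto
  show "compact (A \<union> D \<union> B)"
    using A B D by (simp add: compact_Un)
  have "connected (A \<union> D)"
    using A D 1 by (intro connected_Un) auto
  then show "connected (A \<union> D \<union> B)"
    by (rule connected_Un) (use B 1 in auto)
  have "connected (- (A \<union> D))"
    using Janiszewski_connected[of A D] A D 1(1) by (simp add: compact_imp_closed)
  then show "connected (- (A \<union> D \<union> B))"
    using Janiszewski_connected[of "A \<union> D" B] A B D 1(2) by (simp add: compact_imp_closed compact_Un)
qed

text \<open>What remains is a continuous image of a half-open interval.\<close>

lemma connected_arc_delete_end:
  fixes g :: "real \<Rightarrow> 'a::real_normed_vector"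
  assumes "arc g" "x \<in> {pathstart g, pathfinish g}"
  shows "connected (path_image g - {x})"
proof -
  have inj: "inj_on g {0..1}" and cont: "continuous_on {0..1} g"
    using assms(1) by (auto simp: arc_def path_def)
  have "path_image g - {g t} = g ` ({0..1} - {t})" if "t \<in> {0..1}" for t
    using inj_on_image_set_diff[OF inj, of "{0..1}" "{t}"] that by (simp add: path_image_def)
  moreover have "{0..1} - {0} = {0<..1::real}" "{0..1} - {1} = {0..<1::real}"
    by auto
  ultimately have "path_image g - {pathstart g} = g ` {0<..1}" "path_image g - {pathfinish g} = g ` {0..<1}"
    by (simp_all add: pathstart_def pathfinish_def)
  moreover have "connected (g ` {0<..1})" "connected (g ` {0..<1})"
    by (intro connected_continuous_image continuous_on_subset[OF cont]; auto)+
  ultimately show ?thesis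
    using assms(2) by auto
qed

text \<open>The joining rule mirrors the contraction of an edge. The edge set is recorded because
  only tree edges may be drawn: a cycle would separate the plane.\<close>

inductive tree :: "'a set \<Rightarrow> 'a set set \<Rightarrow> 'a set \<Rightarrow> 'a set set \<Rightarrow> bool" for V E where
  single: "v \<in> V \<Longrightarrow> tree V E {v} {}"
| join: "\<lbrakk>tree V E B F; tree V E C G; B \<inter> C = {}; u \<in> B; w \<in> C; {u, w} \<in> E\<rbrakk>
    \<Longrightarrow> tree V E (B \<union> C) (insert {u, w} (F \<union> G))"

lemma tree_subgraph:
  assumes "tree V E B F"
  shows "B \<noteq> {}" "B \<subseteq> V" "F \<subseteq> E" "f \<in> F \<Longrightarrow> f \<subseteq> B"
  using assms by (induction) auto

locale plane_graph =
  fixes V :: "'a set" and E :: "'a set set" and p :: "'a \<Rightarrow> complex" and \<gamma> :: "'a set \<Rightarrow> real \<Rightarrow> complex"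
  assumes graph: "simple_graph V E" and drawing: "plane_drawing V E p \<gamma>"
begin

lemma edgeD:
  assumes "e \<in> E"
  shows "e \<subseteq> V" "card e = 2" "arc (\<gamma> e)" "{pathstart (\<gamma> e), pathfinish (\<gamma> e)} = p ` e"
    "path_image (\<gamma> e) \<inter> p ` V = p ` e"
  using assms graph drawing unfolding simple_graph_def plane_drawing_def by auto

lemma inj_p: "inj_on p V"
  using drawing unfolding plane_drawing_def by auto

lemma edge_Int: "e \<in> E \<Longrightarrow> f \<in> E \<Longrightarrow> e \<noteq> f \<Longrightarrow> path_image (\<gamma> e) \<inter> path_image (\<gamma> f) = p ` (e \<inter> f)"
  using drawing unfolding plane_drawing_def by auto

lemma edge_vertex_Int:
  assumes "e \<in> E" "B \<subseteq> V"
  shows "path_image (\<gamma> e) \<inter> p ` B = p ` (e \<inter> B)"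
proof -
  have "path_image (\<gamma> e) \<inter> p ` B = p ` e \<inter> p ` B"
    using edgeD(5)[OF assms(1)] assms(2) by blast
  also have "\<dots> = p ` (e \<inter> B)"
    using inj_on_image_Int[OF inj_p edgeD(1)[OF assms(1)] assms(2)] by simp
  finally show ?thesis .
qed

section \<open>Drawn trees as branch sets of a plane graph\<close>

definition drawn :: "'a set \<Rightarrow> 'a set set \<Rightarrow> complex set" where
  "drawn B F = p ` B \<union> (\<Union>f\<in>F. path_image (\<gamma> f))"

text \<open>An edge not contained in \<open>B\<close> is none of the tree edges, so it meets each of
  them only in common end vertices.\<close>

lemma edge_drawn_Int:
  assumes "e \<in> E" "tree V E B F" "\<not> e \<subseteq> B"
  shows "path_image (\<gamma> e) \<inter> drawn B F = p ` (e \<inter> B)"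
proof -
  have "path_image (\<gamma> e) \<inter> path_image (\<gamma> f) \<subseteq> p ` (e \<inter> B)" if "f \<in> F" for f
  proof -
    have "f \<subseteq> B" "f \<in> E" using tree_subgraph[OF assms(2)] that by auto
    then show ?thesis
      using edge_Int[OF assms(1), of f] assms(3) by auto
  qed
  then show ?thesis
    using edge_vertex_Int[OF assms(1) tree_subgraph(2)[OF assms(2)]]
    unfolding drawn_def by blast
qed

lemma drawn_disjoint:
  assumes B: "tree V E B F" and C: "tree V E C G" and "B \<inter> C = {}"
  shows "drawn B F \<inter> drawn C G = {}"
proof -
  have "path_image (\<gamma> f) \<inter> drawn C G = {}" if "f \<in> F" for f
  proof -
    have f: "f \<subseteq> B" "f \<in> E" using tree_subgraph[OF B] that by auto
    then have "f \<inter> C = {}" "f \<noteq> {}" using assms(3) edgeD(2)[of f] by auto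
    then show ?thesis using edge_drawn_Int[OF f(2) C] by auto
  qed
  moreover have "path_image (\<gamma> g) \<inter> p ` B = {}" if "g \<in> G" for g
  proof -
    have "g \<subseteq> C" "g \<in> E" using tree_subgraph[OF C] that by auto
    then show ?thesis
      using edge_vertex_Int[of g B] tree_subgraph(2)[OF B] assms(3) by auto
  qed
  moreover have "p ` B \<inter> p ` C = {}"
    using inj_on_image_Int[OF inj_p tree_subgraph(2)[OF B] tree_subgraph(2)[OF C]] assms(3) by simp
  ultimately show ?thesis
    unfolding drawn_def by blast
qed

lemma arc_facts:
  assumes "e \<in> E"
  shows "compact (path_image (\<gamma> e))" "connected (path_image (\<gamma> e))" "connected (- path_image (\<gamma> e))"
  using edgeD(3)[OF assms] by (auto intro: compact_arc_image connected_arc_image connected_arc_complement)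

text \<open>A single point does not separate the plane, and each join is an instance of
  \<open>bridge\<close> with the new edge as the connecting arc.\<close>

lemma tree_drawn:
  assumes "tree V E B F"
  shows "compact (drawn B F) \<and> connected (drawn B F) \<and> connected (- drawn B F)"
  using assms
proof induction
  case (single v)
  then show ?case
    by (simp add: drawn_def connected_punctured_universe)
next
  case (join B F C G u w)
  have "\<not> {u, w} \<subseteq> B" "\<not> {u, w} \<subseteq> C" "{u, w} \<inter> B = {u}" "{u, w} \<inter> C = {w}"
    using join.hyps by auto
  then have "path_image (\<gamma> {u, w}) \<inter> drawn B F = {p u}" "path_image (\<gamma> {u, w}) \<inter> drawn C G = {p w}"
    using edge_drawn_Int[OF join.hyps(6)] join.hyps(1,2) by auto
  note bridge[OF _ _ _ _ _ _ arc_facts[OF join.hyps(6)] drawn_disjoint[OF join.hyps(1-3)] this]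
  moreover have "drawn (B \<union> C) (insert {u, w} (F \<union> G)) =
      drawn B F \<union> path_image (\<gamma> {u, w}) \<union> drawn C G"
    unfolding drawn_def by auto
  ultimately show ?case
    using join.IH by simp
qed

definition linked :: "'a set \<Rightarrow> 'a set \<Rightarrow> bool" where
  "linked B C \<longleftrightarrow> (\<exists>u\<in>B. \<exists>w\<in>C. {u, w} \<in> E)"

text \<open>Branch sets are the vertex sets carrying some tree of the graph; merging adjacent ones
  is the rule \<open>join\<close>.\<close>

sublocale minor_model "\<lambda>B. \<exists>F. tree V E B F" linked
proof
  show "B \<noteq> {}" if "\<exists>F. tree V E B F" for B
    using that tree_subgraph(1) by blast
  show "\<exists>F. tree V E (B \<union> C) F"
    if BC: "\<exists>F. tree V E B F" "\<exists>F. tree V E C F" "disjnt B C" "linked B C" for B C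
  proof -
    obtain F G u w where *: "tree V E B F" "tree V E C G" "u \<in> B" "w \<in> C" "{u, w} \<in> E"
      using BC(1,2,4) unfolding linked_def by blast
    have "tree V E (B \<union> C) (insert {u, w} (F \<union> G))"
      using BC(3) by (intro join *) (simp add: disjnt_def)
    then show ?thesis ..
  qed
  show "linked C B" if BC: "linked B C" for B C
  proof -
    obtain u w where uw: "u \<in> B" "w \<in> C" "{u, w} \<in> E"
      using BC unfolding linked_def by blast
    have "{w, u} = {u, w}" by blast
    with uw show ?thesis
      unfolding linked_def by metis
  qed
  show "linked C D" if "linked B D" "B \<subseteq> C" for B C D
    using that unfolding linked_def by blast
qed

text \<open>The condition is symmetric in \<open>B\<close> and \<open>C\<close>, so that both orders
  select the same edge.\<close>

definition link_edge :: "'a set \<Rightarrow> 'a set \<Rightarrow> 'a set" where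
  "link_edge B C = (SOME e. e \<in> E \<and> e \<inter> B \<noteq> {} \<and> e \<inter> C \<noteq> {})"

lemma link_edge_commute: "link_edge B C = link_edge C B"
proof -
  have "(\<lambda>e. e \<in> E \<and> e \<inter> B \<noteq> {} \<and> e \<inter> C \<noteq> {}) = (\<lambda>e. e \<in> E \<and> e \<inter> C \<noteq> {} \<and> e \<inter> B \<noteq> {})"
    by blast
  then show ?thesis
    unfolding link_edge_def by (rule arg_cong)
qed

lemma link_edge:
  assumes "linked B C" "disjnt B C"
  obtains u w where "u \<in> B" "w \<in> C" "link_edge B C = {u, w}" "{u, w} \<in> E"
proof -
  have "\<exists>e. e \<in> E \<and> e \<inter> B \<noteq> {} \<and> e \<inter> C \<noteq> {}"
    using assms(1) unfolding linked_def by blast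
  then have "link_edge B C \<in> E \<and> link_edge B C \<inter> B \<noteq> {} \<and> link_edge B C \<inter> C \<noteq> {}"
    unfolding link_edge_def by (rule someI_ex)
  then have e: "link_edge B C \<in> E" "link_edge B C \<inter> B \<noteq> {}" "link_edge B C \<inter> C \<noteq> {}"
    by blast+
  then obtain u w where uw: "u \<in> link_edge B C" "u \<in> B" "w \<in> link_edge B C" "w \<in> C" by blast
  then have "u \<noteq> w" using assms(2) by (auto simp: disjnt_def)
  moreover have "card (link_edge B C) = 2" using edgeD(2) e(1) by blast
  ultimately have "{u, w} = link_edge B C"
    using uw(1,3) by (intro card_subset_eq) (simp_all add: card_ge_0_finite)
  then show thesis
    using that[OF uw(2,4)] e(1) by simp
qed

text \<open>Drawing each branch set by a chosen tree and each adjacency by its chosen edge gives an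
  instance of \<open>k5_drawing\<close>, which \<open>no_five\<close> excludes.\<close>

lemma no_K5_minor: "\<not> K5_minor"
proof
  assume K5_minor
  then obtain K where K: "card K = 5" "branch_sets K" "pairwise linked K"
    unfolding K5_minor_def by blast
  define F where "F B = (SOME F. tree V E B F)" for B
  have tree: "tree V E B (F B)" if "B \<in> K" for B
    using branch_setsD(1)[OF K(2) that] unfolding F_def by (rule someI_ex)
  have disj: "disjnt B D" if "B \<in> K" "D \<in> K" "B \<noteq> D" for B D
    using branch_setsD(2)[OF K(2) that(1,2)] that(3) by simp
  have lk: "linked B D" if "B \<in> K" "D \<in> K" "B \<noteq> D" for B D
    using pairwiseD[OF K(3)] that by simp
  have ends: "\<exists>u w. u \<in> B \<and> w \<in> D \<and> link_edge B D = {u, w} \<and> {u, w} \<in> E"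
    if "B \<in> K" "D \<in> K" "B \<noteq> D" for B D
    by (rule link_edge[OF lk[OF that] disj[OF that]]) blast
  define q where "q B D = (SOME x. path_image (\<gamma> (link_edge B D)) \<inter> drawn B (F B) = {x})" for B D
  interpret k5_drawing K "\<lambda>B. drawn B (F B)" "\<lambda>B D. path_image (\<gamma> (link_edge B D))" q
  proof
    show "compact (drawn B (F B)) \<and> connected (drawn B (F B)) \<and> connected (- drawn B (F B))"
      if "B \<in> K" for B
      using tree_drawn[OF tree[OF that]] .
    show "drawn B (F B) \<inter> drawn D (F D) = {}" if "B \<in> K" "D \<in> K" "B \<noteq> D" for B D
      using drawn_disjoint[OF tree tree] disj[OF that] that by (simp add: disjnt_def)
    show "path_image (\<gamma> (link_edge B D)) = path_image (\<gamma> (link_edge D B))" for B D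
      by (simp only: link_edge_commute[of B D])
  next
    fix B D assume BD: "B \<in> K" "D \<in> K" "B \<noteq> D"
    let ?e = "link_edge B D"
    obtain u w where uw: "u \<in> B" "w \<in> D" "?e = {u, w}" "{u, w} \<in> E"
      using ends[OF BD] by blast
    then have e: "?e \<in> E" by simp
    show "compact (path_image (\<gamma> ?e)) \<and> connected (path_image (\<gamma> ?e)) \<and> connected (- path_image (\<gamma> ?e))"
      using arc_facts[OF e] by blast
    have "?e \<inter> B = {u}" "\<not> ?e \<subseteq> B"
      using uw disj[OF BD] by (auto simp: disjnt_def)
    then have 1: "path_image (\<gamma> ?e) \<inter> drawn B (F B) = {p u}"
      using edge_drawn_Int[OF e tree[OF BD(1)]] by simp
    then have "path_image (\<gamma> ?e) \<inter> drawn B (F B) = {q B D}"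
      unfolding q_def by (rule someI)
    moreover have "path_image (\<gamma> ?e) - drawn B (F B) = path_image (\<gamma> ?e) - {p u}"
      using 1 by blast
    moreover have "connected (path_image (\<gamma> ?e) - {p u})"
      using edgeD(3,4)[OF e] uw by (intro connected_arc_delete_end) auto
    ultimately show "path_image (\<gamma> ?e) \<inter> drawn B (F B) = {q B D} \<and>
        connected (path_image (\<gamma> ?e) - drawn B (F B))"
      by simp
  next
    fix B D L assume *: "B \<in> K" "D \<in> K" "L \<in> K" "B \<noteq> D" "L \<noteq> B" "L \<noteq> D"
    obtain u w where uw: "u \<in> B" "w \<in> D" "link_edge B D = {u, w}" "{u, w} \<in> E"
      using ends[OF *(1,2,4)] by blast
    have "disjnt L B" "disjnt L D"
      using disj * by simp_all
    with uw have "link_edge B D \<inter> L = {}" "\<not> link_edge B D \<subseteq> L"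
      by (auto simp: disjnt_def)
    then show "path_image (\<gamma> (link_edge B D)) \<inter> drawn L (F L) = {}"
      using edge_drawn_Int[of "link_edge B D" L "F L"] uw tree[OF *(3)] by simp
  next
    fix B D L assume *: "B \<in> K" "D \<in> K" "L \<in> K" "B \<noteq> D" "B \<noteq> L" "D \<noteq> L"
    obtain u w where uw: "u \<in> B" "w \<in> D" "link_edge B D = {u, w}" "{u, w} \<in> E"
      using ends[OF *(1,2,4)] by blast
    obtain u' w' where uw': "u' \<in> B" "w' \<in> L" "link_edge B L = {u', w'}" "{u', w'} \<in> E"
      using ends[OF *(1,3,5)] by blast
    have "disjnt B D" "disjnt B L" "disjnt D L" using disj * by auto
    \<comment> \<open>The other ends of the two edges lie in the disjoint sets \<open>D\<close> and
      \<open>L\<close>; hence the edges differ and can share only an end in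
      \<open>B\<close>.\<close>
    then have "{u, w} \<noteq> {u', w'}" "{u, w} \<inter> {u', w'} \<subseteq> B"
      using uw uw' by (auto simp: disjnt_def doubleton_eq_iff)
    then show "path_image (\<gamma> (link_edge B D)) \<inter> path_image (\<gamma> (link_edge B L)) \<subseteq> drawn B (F B)"
      using edge_Int[OF uw(4) uw'(4)] uw(3) uw'(3) unfolding drawn_def by auto
  next
    fix B D L M assume *: "B \<in> K" "D \<in> K" "L \<in> K" "M \<in> K" "distinct [B, D, L, M]"
    have ne: "B \<noteq> D" "B \<noteq> L" "B \<noteq> M" "D \<noteq> L" "D \<noteq> M" "L \<noteq> M" using *(5) by auto
    obtain u w where uw: "u \<in> B" "w \<in> D" "link_edge B D = {u, w}" "{u, w} \<in> E"
      using ends[OF *(1,2) ne(1)] by blast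
    obtain u' w' where uw': "u' \<in> L" "w' \<in> M" "link_edge L M = {u', w'}" "{u', w'} \<in> E"
      using ends[OF *(3,4) ne(6)] by blast
    have "disjnt B L" "disjnt B M" "disjnt D L" "disjnt D M" using disj * ne by auto
    then have "{u, w} \<inter> {u', w'} = {}"
      using uw uw' by (auto simp: disjnt_def)
    then show "path_image (\<gamma> (link_edge B D)) \<inter> path_image (\<gamma> (link_edge L M)) = {}"
      using edge_Int[OF uw(4) uw'(4)] uw(3) uw'(3) by auto
  qed
  have "finite K" using K(1) by (simp add: card_ge_0_finite)
  then obtain xs where xs: "set xs = K" "distinct xs"
    using finite_distinct_list by blast
  have "length xs = 5"
    using K(1) xs distinct_card[of xs] by simp
  then have "\<exists>a b c d e. xs = [a, b, c, d, e]"
    by (simp add: eval_nat_numeral length_Suc_conv) blast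
  then obtain a b c d e where abcde: "xs = [a, b, c, d, e]"
    by blast
  show False
    by (rule no_five[of a b c d e]) (use xs abcde in auto)
qed

text \<open>Singletons serve as the initial branch sets, and each edge yields two ordered pairs.
  Violation of the bound is exactly the density that forces a K5 minor.\<close>

lemma edge_bound:
  assumes "V \<noteq> {}"
  shows "card E + 2 \<le> 3 * card V"
proof (rule ccontr)
  assume "\<not> ?thesis"
  then have many: "6 * card V \<le> 2 * card E + 2" by simp
  have finV: "finite V" and finE: "finite E"
    using graph finite_subset[of E "Pow V"] unfolding simple_graph_def by auto
  define P where "P = (\<lambda>v. {v}) ` V"
  define fiber where "fiber e = {(u, w). {u, w} = e}" for e :: "'a set"
  define r where "r = map_prod (\<lambda>v. {v}) (\<lambda>v. {v}) ` (\<Union>e\<in>E. fiber e)"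
  have fib: "card (fiber e) = 2 \<and> finite (fiber e)" if e: "e \<in> E" for e
  proof -
    obtain u w where "e = {u, w}" "u \<noteq> w"
      using edgeD(2)[OF e] by (auto simp: card_2_iff)
    then have "fiber e = {(u, w), (w, u)}" "u \<noteq> w"
      by (auto simp: fiber_def doubleton_eq_iff)
    then show ?thesis by simp
  qed
  have "card r = card (\<Union>e\<in>E. fiber e)"
    unfolding r_def by (intro card_image) (auto simp: inj_on_def)
  also have "\<dots> = (\<Sum>e\<in>E. card (fiber e))"
    using finE fib by (intro card_UN_disjoint) (auto simp: fiber_def)
  also have "\<dots> = 2 * card E"
    using fib by simp
  finally have card_r: "card r = 2 * card E" .
  have r: "({u}, {w}) \<in> r \<longleftrightarrow> {u, w} \<in> E" for u w
    unfolding r_def fiber_def by auto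
  have r_cases: "\<exists>u w. B = {u} \<and> C = {w} \<and> {u, w} \<in> E" if "(B, C) \<in> r" for B C
    using that unfolding r_def fiber_def by auto
  have "minor_edges P r"
    unfolding minor_edges_def
  proof (intro conjI)
    show "r \<subseteq> P \<times> P"
    proof (rule subrelI)
      fix B C assume "(B, C) \<in> r"
      then obtain u w where "B = {u}" "C = {w}" "{u, w} \<in> E" using r_cases by blast
      then show "(B, C) \<in> P \<times> P" using edgeD(1)[of "{u, w}"] by (auto simp: P_def)
    qed
    show "sym r"
    proof (rule symI)
      fix B C assume "(B, C) \<in> r"
      then obtain u w where "B = {u}" "C = {w}" "{u, w} \<in> E" using r_cases by blast
      then show "(C, B) \<in> r" using r by (metis insert_commute)
    qed
    show "irrefl r"
    proof (rule irreflI)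
      fix B show "(B, B) \<notin> r"
        using r_cases[of B B] edgeD(2) by fastforce
    qed
    show "\<forall>(B, C)\<in>r. linked B C"
      using r_cases unfolding linked_def by blast
  qed
  moreover have "branch_sets P"
    unfolding branch_sets_def P_def pairwise_image by (auto intro: single simp: pairwise_def)
  moreover have "card P = card V"
    unfolding P_def by (intro card_image) auto
  ultimately have K5_minor
    using assms finV many card_r by (intro K5_minor_if_dense[of P r]) (auto simp: P_def)
  then show False using no_K5_minor by blast
qed

end

text \<open>Giving up the additive constant makes the bound hold for the empty graph too.\<close>

lemma planar_card_edges:
  assumes "planar_graph V E"
  shows "card E \<le> 3 * card V"
proof (cases "V = {}")
  case True
  then have "E = {}"
    using assms by (auto simp: planar_graph_def simple_graph_def)
  then show ?thesis by simp
next
  case False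
  obtain p \<gamma> where "plane_graph V E p \<gamma>"
    using assms unfolding planar_graph_def plane_graph_def by blast
  then show ?thesis
    using plane_graph.edge_bound False by fastforce
qed

subsection \<open>Thickness of a semi-bar visibility graph\<close>

lemma planar_graph_no_edges:
  assumes "finite V"
  shows "planar_graph V {}"
proof -
  obtain f :: "'a \<Rightarrow> nat" where "inj_on f V"
    using finite_imp_inj_to_nat_seg[OF assms] by blast
  then have "plane_drawing V {} (\<lambda>v. of_nat (f v)) \<gamma>" for \<gamma>
    by (auto simp: plane_drawing_def inj_on_def)
  then show ?thesis
    using assms unfolding planar_graph_def simple_graph_def by blast
qed

lemma planar_graph_edge:
  assumes "card e = 2"
  shows "planar_graph e {e}"
proof -
  obtain u w where e: "e = {u, w}" "u \<noteq> w"
    using assms by (auto simp: card_2_iff)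
  define p :: "'a \<Rightarrow> complex" where "p v = (if v = u then 0 else 1)" for v
  have "plane_drawing e {e} p (\<lambda>_. linepath 0 1)"
    using e by (auto simp: plane_drawing_def inj_on_def p_def)
  then show ?thesis
    using assms e unfolding planar_graph_def simple_graph_def by auto
qed

text \<open>A witness for the \<open>LEAST\<close> in \<open>thickness\<close>: one subgraph per
  edge, and an edgeless one on all of \<open>V\<close> to pick up isolated vertices.\<close>

lemma ex_union_of_planar_subgraphs:
  assumes "simple_graph V E"
  shows "\<exists>t. union_of_planar_subgraphs t V E"
proof -
  have fin: "finite V" "finite E" and edge: "\<And>e. e \<in> E \<Longrightarrow> e \<subseteq> V \<and> card e = 2"
    using assms finite_subset[of E "Pow V"] unfolding simple_graph_def by auto
  obtain f where f: "bij_betw f {..<card E} E"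
    using ex_bij_betw_nat_finite[OF fin(2)] by (auto simp: atLeast0LessThan)
  define W where "W i = (if i < card E then f i else V)" for i
  define F where "F i = (if i < card E then {f i} else {})" for i
  have fE: "f i \<in> E" if "i < card E" for i
    using f that by (auto simp: bij_betw_def)
  have "simple_subgraph (W i) (F i) V E \<and> planar_graph (W i) (F i)" for i
  proof -
    have "planar_graph (W i) (F i)"
      using planar_graph_no_edges[OF fin(1)] planar_graph_edge edge[OF fE] by (auto simp: W_def F_def)
    moreover have "W i \<subseteq> V" "F i \<subseteq> E"
      using edge fE by (auto simp: W_def F_def)
    ultimately show ?thesis
      unfolding simple_subgraph_def planar_graph_def by blast
  qed
  moreover have "(\<Union>i<Suc (card E). W i) = V"
    using edge fE by (auto simp: W_def lessThan_Suc)
  moreover have "(\<Union>i<Suc (card E). F i) = E"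
    using f by (auto simp: F_def lessThan_Suc bij_betw_def)
  ultimately show ?thesis
    unfolding union_of_planar_subgraphs_def by blast
qed

lemma card_edges_le_thickness:
  assumes "simple_graph V E"
  shows "card E \<le> 3 * thickness V E * card V"
proof -
  have "union_of_planar_subgraphs (thickness V E) V E"
    unfolding thickness_def by (rule LeastI_ex[OF ex_union_of_planar_subgraphs[OF assms]])
  then obtain W F where
    WF: "\<And>i. i < thickness V E \<Longrightarrow> simple_subgraph (W i) (F i) V E \<and> planar_graph (W i) (F i)"
    and E: "(\<Union>i<thickness V E. F i) = E"
    unfolding union_of_planar_subgraphs_def by blast
  have finV: "finite V"
    using assms by (simp add: simple_graph_def)
  have "card (F i) \<le> 3 * card V" if "i < thickness V E" for i
  proof -
    have "card (W i) \<le> card V"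
      using WF[OF that] finV by (intro card_mono) (auto simp: simple_subgraph_def)
    moreover have "card (F i) \<le> 3 * card (W i)"
      using planar_card_edges WF[OF that] by blast
    ultimately show ?thesis by linarith
  qed
  then have "(\<Sum>i<thickness V E. card (F i)) \<le> (\<Sum>i<thickness V E. 3 * card V)"
    by (intro sum_mono) simp
  moreover have "card E \<le> (\<Sum>i<thickness V E. card (F i))"
    using card_UN_le[of "{..<thickness V E}" F] E by simp
  ultimately show ?thesis by simp
qed

section \<open>Visibility between bars\<close>

lemma vertical_segment_meets_bar:
  assumes "l \<le> r"
  shows "vertical_segment x a b \<inter> horizontal_bar l r y \<noteq> {} \<longleftrightarrow> l \<le> x \<and> x \<le> r \<and> y \<in> closed_segment a b"
proof -
  have "vertical_segment x a b = {z. Re z = x \<and> Im z \<in> closed_segment a b}"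
    unfolding vertical_segment_def by (subst closed_segment_same_Re) auto
  moreover have "horizontal_bar l r y = {z. Im z = y \<and> Re z \<in> {l..r}}"
    unfolding horizontal_bar_def using assms
    by (subst closed_segment_same_Im) (auto simp: closed_segment_eq_real_ivl)
  ultimately show ?thesis
    by (auto intro: exI[of _ "Complex x y"] simp: ex_in_conv[symmetric] simp del: ex_in_conv)
qed

definition bar_sight ::
  "nat \<Rightarrow> 'a set \<Rightarrow> ('a \<Rightarrow> real) \<Rightarrow> ('a \<Rightarrow> real) \<Rightarrow> ('a \<Rightarrow> real) \<Rightarrow> 'a \<Rightarrow> 'a \<Rightarrow> bool" where
  "bar_sight k V l r y u v \<longleftrightarrow>
    (\<exists>x a b.
      vertical_segment x a b \<inter> horizontal_bar (l u) (r u) (y u) \<noteq> {} \<and>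
      vertical_segment x a b \<inter> horizontal_bar (l v) (r v) (y v) \<noteq> {} \<and>
      card {w \<in> V - {u, v}. vertical_segment x a b \<inter> horizontal_bar (l w) (r w) (y w) \<noteq> {}} \<le> k)"

lemma bar_sight_commute: "bar_sight k V l r y u v \<longleftrightarrow> bar_sight k V l r y v u"
  unfolding bar_sight_def insert_commute[of u v] by blast

definition sight_edges ::
  "nat \<Rightarrow> 'a set \<Rightarrow> ('a \<Rightarrow> real) \<Rightarrow> ('a \<Rightarrow> real) \<Rightarrow> ('a \<Rightarrow> real) \<Rightarrow> 'a set set" where
  "sight_edges k V l r y = {{u, v} | u v. u \<in> V \<and> v \<in> V \<and> u \<noteq> v \<and> bar_sight k V l r y u v}"

text \<open>Distinct heights make the bars disjoint, and the edge set is read off from visibility,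
  so that the equivalence holds by construction.\<close>

lemma bar_visibility_representation_sight_edges:
  assumes "finite V" "\<And>v. v \<in> V \<Longrightarrow> l v < r v" "inj_on y V"
  shows "bar_visibility_representation k V (sight_edges k V l r y) l r y"
  unfolding bar_visibility_representation_def bar_sight_def[symmetric]
proof (intro conjI ballI impI)
  show "simple_graph V (sight_edges k V l r y)"
    using assms(1) by (auto simp: simple_graph_def sight_edges_def)
  show "disjoint_family_on (\<lambda>v. horizontal_bar (l v) (r v) (y v)) V"
    using assms(3)
    by (auto simp: disjoint_family_on_def horizontal_bar_def closed_segment_same_Im inj_on_def)
  show "{u, v} \<in> sight_edges k V l r y \<longleftrightarrow> bar_sight k V l r y u v"
    if "u \<in> V" "v \<in> V" "u \<noteq> v" for u v
    using that bar_sight_commute[of k V l r y u v] unfolding sight_edges_def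
    by (auto simp: doubleton_eq_iff)
qed (use assms in auto)

text \<open>Bar \<open>i\<close> has length \<open>i + 1\<close>, and longer bars lie further out on alternating sides. At the right end of
  bar \<open>i\<close> only longer bars can block, and those between \<open>i\<close> and \<open>j > i\<close> lie on the side of \<open>j\<close>; so \<open>i\<close>
  sees \<open>j\<close> whenever \<open>j - i \<le> 2 k + 2\<close>.\<close>

definition zigzag :: "nat \<Rightarrow> real" where
  "zigzag i = (if even i then real i else - real i)"

lemma inj_zigzag: "inj zigzag"
  by (auto simp: inj_def zigzag_def split: if_splits)

text \<open>The index is the absolute value of the height. A larger index on the side opposite to
  \<open>j\<close> lies beyond the segment, and so does an index above \<open>j\<close> on its own
  side.\<close>

lemma zigzag_between:
  assumes "i < j" "i < w" "w \<noteq> j" "zigzag w \<in> closed_segment (zigzag i) (zigzag j)"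
  shows "w < j" "even (j - w)"
proof -
  have "w < j \<and> (even w \<longleftrightarrow> even j)"
    using assms by (auto simp: zigzag_def closed_segment_eq_real_ivl split: if_splits)
  then show "w < j" "even (j - w)"
    by auto
qed

lemma zigzag_sight:
  assumes "i < j" "j \<le> i + (2 * k + 2)"
  shows "bar_sight k V (\<lambda>_. 0) (\<lambda>v. real v + 1) zigzag i j"
  unfolding bar_sight_def
proof (intro exI conjI)
  \<comment> \<open>At the right end of bar \<open>i\<close> every shorter bar has already ended,
    while bar \<open>j\<close> is still present.\<close>
  let ?s = "vertical_segment (real i + 1) (zigzag i) (zigzag j)"
  show "?s \<inter> horizontal_bar 0 (real i + 1) (zigzag i) \<noteq> {}"
    "?s \<inter> horizontal_bar 0 (real j + 1) (zigzag j) \<noteq> {}"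
    using assms(1) by (simp_all add: vertical_segment_meets_bar)
  \<comment> \<open>A blocker is \<open>j - 2 * m\<close> with \<open>m \<ge> 1\<close>. It exceeds
    \<open>i\<close>, and \<open>j\<close> is at most \<open>i + (2 * k + 2)\<close>, so
    \<open>m \<le> k\<close>.\<close>
  have "{w \<in> V - {i, j}. ?s \<inter> horizontal_bar 0 (real w + 1) (zigzag w) \<noteq> {}} \<subseteq> (\<lambda>m. j - 2 * m) ` {1..k}"
  proof
    fix w assume "w \<in> {w \<in> V - {i, j}. ?s \<inter> horizontal_bar 0 (real w + 1) (zigzag w) \<noteq> {}}"
    then have w: "i < w" "w \<noteq> j" "zigzag w \<in> closed_segment (zigzag i) (zigzag j)"
      by (auto simp: vertical_segment_meets_bar)
    obtain m where "j - w = 2 * m"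
      using zigzag_between(2)[OF assms(1) w] by (rule evenE)
    then have "w = j - 2 * m" "m \<in> {1..k}"
      using zigzag_between(1)[OF assms(1) w] w(1) assms(2) by auto
    then show "w \<in> (\<lambda>m. j - 2 * m) ` {1..k}" by blast
  qed
  then show "card {w \<in> V - {i, j}. ?s \<inter> horizontal_bar 0 (real w + 1) (zigzag w) \<noteq> {}} \<le> k"
    using surj_card_le[of "{1..k}"] by simp
qed

text \<open>Edges are counted by their smaller end \<open>i\<close> and the difference
  \<open>d\<close>; the bound on \<open>i\<close> keeps \<open>i + d\<close> below
  \<open>n\<close>.\<close>

lemma card_zigzag_edges:
  "(n - (2 * k + 2)) * (2 * k + 2) \<le> card (sight_edges k {..<n} (\<lambda>_. 0) (\<lambda>v. real v + 1) zigzag)"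
    (is "_ \<le> card ?E")
proof -
  let ?P = "{..<n - (2 * k + 2)} \<times> {1..2 * k + 2}"
  have "inj_on (\<lambda>(i, d). {i, i + d}) ?P"
    by (auto simp: inj_on_def doubleton_eq_iff)
  moreover have "(\<lambda>(i, d). {i, i + d}) ` ?P \<subseteq> ?E"
  proof
    fix e assume "e \<in> (\<lambda>(i, d). {i, i + d}) ` ?P"
    then obtain i d where e: "e = {i, i + d}" "i < n - (2 * k + 2)" "1 \<le> d" "d \<le> 2 * k + 2"
      by auto
    then have "bar_sight k {..<n} (\<lambda>_. 0) (\<lambda>v. real v + 1) zigzag i (i + d)"
      by (intro zigzag_sight) auto
    moreover have "i \<in> {..<n}" "i + d \<in> {..<n}" "i \<noteq> i + d"
      using e by auto
    ultimately show "e \<in> ?E"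
      unfolding sight_edges_def e(1) by blast
  qed
  moreover have "finite ?E"
    by (rule finite_subset[of _ "Pow {..<n}"]) (auto simp: sight_edges_def)
  ultimately have "card ?P \<le> card ?E"
    by (rule card_inj_on_le)
  then show ?thesis by simp
qed

theorem theorem8:
  fixes k :: nat
  shows "\<exists>(V :: nat set) E. semi_bar_visibility_graph k V E \<and>
           int (thickness V E) \<ge> \<lceil>2 / 3 * (real k + 1)\<rceil>"
proof -
  define m where "m = 2 * k + 2"
  \<comment> \<open>If \<open>3 * t\<close> were at most \<open>m - 1\<close>, the two edge counts
    would give \<open>m * (n - m) \<le> (m - 1) * n\<close>, that is \<open>n \<le> m * m\<close>.
    The value chosen is the least one excluding this.\<close>
  define n where "n = m * m + 1"
  define E where "E = sight_edges k {..<n} (\<lambda>_. 0) (\<lambda>v. real v + 1) zigzag"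
  have rep: "bar_visibility_representation k {..<n} E (\<lambda>_. 0) (\<lambda>v. real v + 1) zigzag"
    unfolding E_def using inj_zigzag
    by (intro bar_visibility_representation_sight_edges) (auto intro: inj_on_subset)
  define t where "t = thickness {..<n} E"
  have "m \<le> 3 * t"
  proof (rule ccontr)
    assume "\<not> ?thesis"
    then have "(3 * t + 1) * n \<le> m * n"
      by (intro mult_le_mono1) simp
    also have "m * n = (n - m) * m + m * m"
    proof -
      have "m \<le> n"
        unfolding n_def by (cases m) auto
      then show ?thesis
        using add_mult_distrib[of "n - m" m m] by (simp add: mult.commute)
    qed
    also have "(n - m) * m \<le> card E"
      unfolding E_def m_def by (rule card_zigzag_edges)
    also have "card E \<le> 3 * t * n"
      using card_edges_le_thickness[of "{..<n}" E] rep
      by (simp add: t_def bar_visibility_representation_def)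
    finally have "n \<le> m * m" by simp
    then show False by (simp add: n_def)
  qed
  then have "2 / 3 * (real k + 1) \<le> real t"
    unfolding m_def by simp
  then have "\<lceil>2 / 3 * (real k + 1)\<rceil> \<le> int t"
    by (simp add: ceiling_le_iff)
  moreover have "semi_bar_visibility_graph k {..<n} E"
    using rep unfolding semi_bar_visibility_graph_def by blast
  ultimately show ?thesis
    unfolding t_def by blast
qed

end
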